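(* Let $F$ be a subfield of $\mathbb{R}$ with $F\neq\mathbb{R}$. Then $\mathbb{R}\setminus F$ is $CT_2$. In particular, the space of irrational numbers is $CT_2$.
   Context: Subsets of $\mathbb{R}$ carry the subspace topology from the usual Euclidean topology. For a $T_1$-space $X$, $\mathrm{Cld}(X)$ denotes the set of all non-empty closed subsets of $X$, endowed with the Vietoris topology, i.e. the topology having as a subbase all sets $U^-=\{A\in\mathrm{Cld}(X): A\cap U\neq\emptyset\}$ and $U^+=\{A\in\mathrm{Cld}(X): A\subseteq U\}$ with $U$ open in $X$. $X$ is called $CT_2$ if there is a continuous map $\phi=(\phi_1,\phi_2):X^2\setminus\{(x,x):x\in X\}\to\mathrm{Cld}(X)^2$ (domain with the subspace topology from $X^2$) such that for all $x_1\neq x_2$ in $X$: $\phi_1(x_1,x_2)\cup\phi_2(x_1,x_2)=X$, $x_1\notin\phi_1(x_1,x_2)$ and $x_2\notin\phi_2(x_1,x_2)$. *)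

theory Defs
  imports "HOL-Algebra.Algebraic_Closure_Type" "HOL-Analysis.Analysis"
begin

definition Cld :: "'a topology \<Rightarrow> 'a set set" where
  "Cld T = {A. closedin T A \<and> A \<noteq> {}}"

definition vietoris :: "'a topology \<Rightarrow> 'a set topology" where
  "vietoris T = topology_generated_by
     ({{A \<in> Cld T. A \<inter> U \<noteq> {}} | U. openin T U} \<union> {{A \<in> Cld T. A \<subseteq> U} | U. openin T U})"

(* Hence continuity of a map into this space includes that its values are non-empty and closed. *)
lemma topspace_vietoris: "topspace (vietoris T) = Cld T"
proof -
  have "\<exists>U. openin T U \<and> A \<subseteq> U" if "A \<in> Cld T" for A
    using that closedin_subset[of T A] openin_topspace[of T] by (auto simp: Cld_def)
  then show ?thesis
    unfolding vietoris_def topology_generated_by_topspace by blast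
qed

(* T1 is the standing assumption under which the hyperspace and the property CT2 are considered. *)
definition CT2_space :: "'a topology \<Rightarrow> bool" where
  "CT2_space T \<longleftrightarrow> t1_space T \<and>
     (\<exists>\<phi>. continuous_map
            (subtopology (prod_topology T T)
               (topspace T \<times> topspace T - {(x, x) | x. x \<in> topspace T}))
            (prod_topology (vietoris T) (vietoris T)) \<phi> \<and>
          (\<forall>x\<^sub>1\<in>topspace T. \<forall>x\<^sub>2\<in>topspace T. x\<^sub>1 \<noteq> x\<^sub>2 \<longrightarrow>
             fst (\<phi> (x\<^sub>1, x\<^sub>2)) \<union> snd (\<phi> (x\<^sub>1, x\<^sub>2)) = topspace T \<and>
             x\<^sub>1 \<notin> fst (\<phi> (x\<^sub>1, x\<^sub>2)) \<and>
             x\<^sub>2 \<notin> snd (\<phi> (x\<^sub>1, x\<^sub>2))))"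

abbreviation real_field :: "real ring" where
  "real_field \<equiv> ring_of_type_algebra"

lemma real_field_simps: "carrier real_field = UNIV" "x \<otimes>\<^bsub>real_field\<^esub> y = x * y" "\<one>\<^bsub>real_field\<^esub> = 1"
   "\<zero>\<^bsub>real_field\<^esub> = 0" "x \<oplus>\<^bsub>real_field\<^esub> y = x + y"
  by (simp_all add: ring_of_type_algebra_def)

lemma real_field_a_inv: "\<ominus>\<^bsub>real_field\<^esub> x = - x"
proof -
  interpret field real_field by (rule field_from_type_algebra)
  show ?thesis
    by (rule minus_equality) (auto simp: real_field_simps)
qed

lemma real_field_m_inv: "x \<noteq> 0 \<Longrightarrow> inv\<^bsub>real_field\<^esub> x = inverse x"
proof -
  interpret field real_field by (rule field_from_type_algebra)
  show "x \<noteq> 0 \<Longrightarrow> inv\<^bsub>real_field\<^esub> x = inverse x"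
    by (intro inv_char) (auto simp: real_field_simps)
qed

lemma subfield_real_field_iff:
  "subfield F real_field \<longleftrightarrow>
     0 \<in> F \<and> 1 \<in> F \<and> (\<forall>x\<in>F. \<forall>y\<in>F. x - y \<in> F \<and> x * y \<in> F) \<and> (\<forall>x\<in>F. inverse x \<in> F)" (is "?L \<longleftrightarrow> ?R")
proof -
  interpret field real_field by (rule field_from_type_algebra)
  show ?thesis
  proof
    assume L: ?L
    note sr = subringE[OF subfieldE(1)[OF L]]
    have inv: "inverse x \<in> F" if "x \<in> F" for x
      using subfield_m_inv(1)[OF L, of x] sr(2) that
      by (cases "x = 0") (auto simp: real_field_simps real_field_m_inv)
    have "x - y \<in> F" if "x \<in> F" "y \<in> F" for x y
      using sr(7)[OF that(1) sr(5)[OF that(2)]] by (simp add: real_field_simps real_field_a_inv)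
    then show ?R
      using sr inv by (auto simp: real_field_simps)
  next
    assume R: ?R
    have neg: "- x \<in> F" if "x \<in> F" for x using R that by (metis diff_0)
    have add: "x + y \<in> F" if "x \<in> F" "y \<in> F" for x y using R that neg by (metis diff_minus_eq_add)
    show ?L
      by (rule subfieldI', rule subringI)
        (use R neg add in \<open>auto simp: real_field_simps real_field_a_inv real_field_m_inv\<close>)
  qed
qed
end

theory Submission
  imports Defs
begin

text \<open>
  The reason is that the rationals lie in \<open>F\<close>. Enumerate them as \<open>d 0, d 1, \<dots>\<close>. No \<open>d k\<close> belongs to
  \<open>A = \<real> - F\<close>, so each \<open>d k\<close> cuts \<open>A\<close> into two complementary clopen rays, and any two distinct
  points of \<open>A\<close> are separated by some \<open>d k\<close>. Given \<open>x\<^sub>1 \<noteq> x\<^sub>2\<close>, take the first \<open>d k\<close> strictly between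
  them, and let \<open>\<phi>\<^sub>1(x\<^sub>1, x\<^sub>2)\<close> be the ray of \<open>A\<close> at \<open>d k\<close> that contains \<open>x\<^sub>2\<close>, and \<open>\<phi>\<^sub>2(x\<^sub>1, x\<^sub>2)\<close> the ray
  that contains \<open>x\<^sub>1\<close>. Which \<open>d k\<close> is selected depends only on the sides on which \<open>x\<^sub>1\<close> and \<open>x\<^sub>2\<close> lie
  of the finitely many points \<open>d 0, \<dots>, d k\<close>; these sides do not change under small perturbations.
  Hence \<open>\<phi>\<close> is locally constant, and therefore continuous whatever topology its range carries.

  The argument uses only a countable set of cut points outside \<open>A\<close> that separates the points
  of \<open>A\<close>, and lemma \<open>CT2_space_if_separating_sequence\<close> is stated in this form.
\<close>

lemma continuous_map_if_locally_constant:
  assumes "\<And>x. x \<in> topspace T \<Longrightarrow> f x \<in> topspace S"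
    and "\<And>x. x \<in> topspace T \<Longrightarrow> \<exists>W. openin T W \<and> x \<in> W \<and> (\<forall>y\<in>W. f y = f x)"
  shows "continuous_map T S f"
proof -
  have "openin T {x \<in> topspace T. f x \<in> U}" for U
  proof -
    have "\<exists>W. openin T W \<and> x \<in> W \<and> W \<subseteq> {x \<in> topspace T. f x \<in> U}"
      if x: "x \<in> topspace T" "f x \<in> U" for x
    proof -
      obtain W where W: "openin T W" "x \<in> W" "\<forall>y\<in>W. f y = f x"
        using assms(2)[OF x(1)] by blast
      have "W \<subseteq> {x \<in> topspace T. f x \<in> U}"
        using W(3) x(2) openin_subset[OF W(1)] by auto
      then show ?thesis using W(1,2) by blast
    qed
    then show ?thesis by (subst openin_subopen) blast
  qed
  then show ?thesis using assms(1) by (simp add: continuous_map_def Pi_iff)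
qed

text \<open>The part of \<open>A\<close> on the same side of the cut point \<open>d\<close> as \<open>x\<close>. It is only used for \<open>d \<notin> A\<close>;
  the points of \<open>A\<close> not above \<open>d\<close> are then exactly those below \<open>d\<close>.\<close>
definition ray :: "'a::linorder set \<Rightarrow> 'a \<Rightarrow> 'a \<Rightarrow> 'a set" where
  "ray A d x = {y \<in> A. d < y \<longleftrightarrow> d < x}"

lemma ray_clopen:
  fixes d :: "'a::linorder_topology"
  assumes "d \<notin> A"
  shows "openin (top_of_set A) (ray A d x)" "closedin (top_of_set A) (ray A d x)"
proof -
  have sides: "d < y \<or> y < d" if "y \<in> A" for y
    using that assms by (metis linorder_neqE)
  show "openin (top_of_set A) (ray A d x)"
  proof (cases "d < x")
    case True
    then have "ray A d x = A \<inter> {d<..}" by (auto simp: ray_def)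
    then show ?thesis by (simp only: openin_open_Int open_greaterThan)
  next
    case False
    then have "ray A d x = A \<inter> {..<d}" using sides by (auto simp: ray_def)
    then show ?thesis by (simp only: openin_open_Int open_lessThan)
  qed
  show "closedin (top_of_set A) (ray A d x)"
  proof (cases "d < x")
    case True
    then have "ray A d x = A \<inter> {d..}" using sides by (fastforce simp: ray_def)
    then show ?thesis by (simp only: closedin_closed_Int closed_atLeast)
  next
    case False
    then have "ray A d x = A \<inter> {..d}" by (auto simp: ray_def)
    then show ?thesis by (simp only: closedin_closed_Int closed_atMost)
  qed
qed

lemma CT2_space_if_separating_sequence:
  fixes A :: "'a::linorder_topology set" and d :: "nat \<Rightarrow> 'a"
  assumes notin: "\<And>k. d k \<notin> A"
    and sep: "\<And>x y. x \<in> A \<Longrightarrow> y \<in> A \<Longrightarrow> x < y \<Longrightarrow> \<exists>k. x < d k \<and> d k < y"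
  shows "CT2_space (top_of_set A)"
proof -
  define n where "n x y = (LEAST k. (d k < x) \<noteq> (d k < y))" for x y
  define \<phi> where "\<phi> = (\<lambda>(x, y). (ray A (d (n x y)) y, ray A (d (n x y)) x))"
  let ?P = "subtopology (prod_topology (top_of_set A) (top_of_set A)) (A \<times> A - {(x, x) | x. x \<in> A})"
  have n: "(d (n x y) < x) \<noteq> (d (n x y) < y)" if "x \<in> A" "y \<in> A" "x \<noteq> y" for x y
  proof -
    have "\<exists>k. (d k < x) \<noteq> (d k < y)"
    proof (cases "x < y")
      case True
      then show ?thesis using sep[OF that(1,2)] by (meson order_less_asym)
    next
      case False
      then show ?thesis using sep[OF that(2,1)] that(3) by (meson linorder_neqE order_less_asym)
    qed
    then show ?thesis unfolding n_def by (rule LeastI_ex)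
  qed
  have n_cong: "n x y = n a b"
    if "a \<in> A" "b \<in> A" "a \<noteq> b"
      and same: "\<And>k. k \<le> n a b \<Longrightarrow> (d k < x) = (d k < a) \<and> (d k < y) = (d k < b)" for a b x y
    unfolding n_def[of x y]
  proof (rule Least_equality)
    show "(d (n a b) < x) \<noteq> (d (n a b) < y)"
      using n[OF that(1-3)] same[of "n a b"] by simp
    show "n a b \<le> k" if k: "(d k < x) \<noteq> (d k < y)" for k
    proof (rule ccontr)
      assume "\<not> n a b \<le> k"
      then have "(d k < a) \<noteq> (d k < b)" using k same[of k] by simp
      then have "n a b \<le> k" unfolding n_def by (rule Least_le)
      with \<open>\<not> n a b \<le> k\<close> show False by simp
    qed
  qed
  have "continuous_map ?P (prod_topology (vietoris (top_of_set A)) (vietoris (top_of_set A))) \<phi>"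
  proof (rule continuous_map_if_locally_constant)
    fix p assume p: "p \<in> topspace ?P"
    then obtain a b where ab: "p = (a, b)" "a \<in> A" "b \<in> A" "a \<noteq> b"
      by (cases p) auto
    have "a \<in> ray A (d (n a b)) a" "b \<in> ray A (d (n a b)) b"
      using ab by (simp_all add: ray_def)
    then show "\<phi> p \<in> topspace (prod_topology (vietoris (top_of_set A)) (vietoris (top_of_set A)))"
      using ray_clopen(2)[OF notin] by (auto simp: ab \<phi>_def topspace_vietoris Cld_def)
    \<comment> \<open>Near \<open>p\<close> all the sides that determine the selected cut point stay the same.\<close>
    define N where "N c = (\<Inter>k\<le>n a b. ray A (d k) c)" for c
    have N: "openin (top_of_set A) (N c)" for c
      unfolding N_def by (intro openin_INT2 ray_clopen(1) notin) auto
    let ?W = "(A \<times> A - {(x, x) | x. x \<in> A}) \<inter> N a \<times> N b"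
    have "openin ?P ?W"
      by (intro openin_subtopology_Int2) (simp only: openin_prod_Times_iff N simp_thms)
    moreover have "p \<in> ?W"
      using ab by (auto simp: N_def ray_def)
    moreover have "\<phi> q = \<phi> p" if q: "q \<in> ?W" for q
    proof -
      obtain x y where xy: "q = (x, y)" by (cases q)
      have same: "(d k < x) = (d k < a) \<and> (d k < y) = (d k < b)" if "k \<le> n a b" for k
        using q that by (auto simp: xy N_def ray_def)
      show ?thesis
        using n_cong[OF ab(2-4) same] same[of "n a b"] by (simp add: \<phi>_def xy ab(1) ray_def)
    qed
    ultimately show "\<exists>W. openin ?P W \<and> p \<in> W \<and> (\<forall>q\<in>W. \<phi> q = \<phi> p)"
      by blast
  qed
  moreover have "\<forall>x\<in>A. \<forall>y\<in>A. x \<noteq> y \<longrightarrow>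
      fst (\<phi> (x, y)) \<union> snd (\<phi> (x, y)) = A \<and> x \<notin> fst (\<phi> (x, y)) \<and> y \<notin> snd (\<phi> (x, y))"
  proof (intro ballI impI)
    fix x y assume "x \<in> A" "y \<in> A" "x \<noteq> y"
    then show "fst (\<phi> (x, y)) \<union> snd (\<phi> (x, y)) = A \<and> x \<notin> fst (\<phi> (x, y)) \<and> y \<notin> snd (\<phi> (x, y))"
      using n[of x y] by (auto simp: \<phi>_def ray_def)
  qed
  moreover have "t1_space (top_of_set A)"
    by (intro t1_space_subtopology) (simp add: t1_space_closedin_singleton)
  ultimately show ?thesis
    unfolding CT2_space_def topspace_euclidean_subtopology by (intro conjI exI[of _ \<phi>])
qed

lemma CT2_space_if_disjoint_Rats:
  fixes A :: "real set"
  assumes "A \<inter> \<rat> = {}"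
  shows "CT2_space (top_of_set A)"
proof (rule CT2_space_if_separating_sequence)
  have range: "range (from_nat_into (\<rat> :: real set)) = \<rat>"
    by (intro range_from_nat_into countable_rat) (use Rats_0 in blast)
  show "from_nat_into \<rat> k \<notin> A" for k
    using range assms by blast
  show "\<exists>k. x < from_nat_into \<rat> k \<and> from_nat_into \<rat> k < y" if "x < y" for x y :: real
  proof -
    have "\<exists>r\<in>range (from_nat_into \<rat>). x < r \<and> r < y"
      unfolding range by (rule Rats_dense_in_real[OF that])
    then show ?thesis by blast
  qed
qed

lemma Rats_subset_subfield:
  assumes "subfield F real_field"
  shows "\<rat> \<subseteq> F"
proof -
  have F: "0 \<in> F" "1 \<in> F" "\<And>x y. x \<in> F \<Longrightarrow> y \<in> F \<Longrightarrow> x - y \<in> F \<and> x * y \<in> F"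
    "\<And>x. x \<in> F \<Longrightarrow> inverse x \<in> F"
    using assms unfolding subfield_real_field_iff by auto
  have nat: "of_nat k \<in> F" for k
  proof (induction k)
    case (Suc k)
    have "of_nat k - (0 - 1) \<in> F" using F Suc by blast
    then show ?case by (simp add: add.commute)
  qed (simp add: F)
  have int: "of_int i \<in> F" for i
  proof (cases i)
    case (neg k)
    have "0 - of_nat (Suc k) \<in> F" using F nat by blast
    then show ?thesis by (simp add: neg)
  qed (simp add: nat)
  show ?thesis
  proof
    fix x :: real assume "x \<in> \<rat>"
    then obtain i j where "x = of_int i / of_int j"
      by (auto elim: Rats_cases')
    then show "x \<in> F" using F int by (simp add: divide_inverse)
  qed
qed

theorem mainTheorem13:
  shows "(\<forall>F :: real set. subfield F real_field \<and> F \<noteq> UNIV \<longrightarrow> CT2_space (top_of_set (UNIV - F))) \<and>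
         CT2_space (top_of_set (UNIV - \<rat> :: real set))"
proof (intro conjI allI impI)
  fix F :: "real set" assume "subfield F real_field \<and> F \<noteq> UNIV"
  then have "(UNIV - F) \<inter> \<rat> = {}"
    using Rats_subset_subfield by blast
  then show "CT2_space (top_of_set (UNIV - F))"
    by (rule CT2_space_if_disjoint_Rats)
qed (rule CT2_space_if_disjoint_Rats, blast)

end
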